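(* Let $D\in\{0,1\}^{m\times n}$ be a data matrix. For any code table $CT=\{(X_\sigma,C_\sigma)\mid 1\le\sigma\le\tau\}$ and its cover function $cover$, with the non-singleton patterns of $CT$ being indexed by $1\le\sigma\le r$, there exists a Boolean matrix factorization $D=\theta(YX^T)+N$ with $X\in\{0,1\}^{n\times r}$, $Y\in\{0,1\}^{m\times r}$ and $N\in\{-1,0,1\}^{m\times n}$ such that the non-singleton patterns in $CT$ are mirrored in $X$ (that is, $X_{is}=1\Leftrightarrow i\in X_s$ for all $1\le i\le n$, $1\le s\le r$) and the cover function is reflected by $Y$ (that is, $Y_{js}=1\Leftrightarrow X_s\in cover(CT,D_{j\cdot})$ for all $1\le j\le m$, $1\le s\le r$). Moreover, the description lengths correspond to each other: $$L_{\mathsf{CT}}(D,CT)=f_{\mathsf{CT}}(X,Y,D)=f^D_{\mathsf{CT}}(X,Y,D)+f^M_{\mathsf{CT}}(X,Y,D),$$ where $$f^D_{\mathsf{CT}}(X,Y,D)=-\sum_{s=1}^r|Y_{\cdot s}|\cdot\log(p_s)-\sum_{i=1}^n|N_{\cdot i}|\cdot\log(p_{r+i})=L^D_{\mathsf{CT}}(D,CT),$$ $$f^M_{\mathsf{CT}}(X,Y,D)=\sum_{s:|Y_{\cdot s}|>0}\left(X_{\cdot s}^Tc-\log(p_s)\right)+\sum_{i:|N_{\cdot i}|>0}\left(c_i-\log(p_{r+i})\right)=L^M_{\mathsf{CT}}(CT),$$ with $$p_s=\frac{|Y_{\cdot s}|}{|Y|+|N|},\qquad p_{r+i}=\frac{|N_{\cdot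 i}|}{|Y|+|N|},\qquad c_i=-\log\left(\frac{|D_{\cdot i}|}{|D|}\right),\quad c=(c_i)_{1\le i\le n}.$$
   Context: Items are $\mathcal I=\{1,\dots,n\}$ and transactions are $\mathcal T=\{1,\dots,m\}$. The $j$-th transaction is the row $D_{j\cdot}$, identified with the item set $\{i: D_{ji}=1\}$. $\log$ is the natural logarithm and $|\cdot|$ is the entry-wise $1$-norm (sum of absolute values of entries). $Z_{\cdot s}$ denotes the $s$-th column of a matrix $Z$. The function $\theta$ acts entry-wise, with $\theta(x)=1$ if $x\ge 0.5$ and $\theta(x)=0$ otherwise, so $\theta(YX^T)$ is the Boolean matrix product. Code tables. A pattern is a (nonempty) set of items. A code table $CT=\{(X_\sigma,C_\sigma)\mid 1\le\sigma\le\tau\}$ is a list of $\tau$ distinct patterns $X_\sigma\subseteq\mathcal I$ with assigned codes $C_\sigma$; only the code lengths below matter. $r$ is the number of patterns with at least two items (non-singleton patterns), and the indexing is such that these are $X_1,\dots,X_r$. The cover function assigns to each transaction $D_{j\cdot}$ a set $cover(CT,D_{j\cdot})$ of patterns of the code table that forms a partition of the item set of $D_{j\cdot}$ (so the covering patterns are pairwise disjoint, contained in the transaction, and their union is the transaction). Description length. Put $$usage(X_\sigma)=|\{j\in\mathcal T\mid X_\sigma\in cover(CT,D_{j\cdot})\}|,\qquad P(X_\sigma)=\frac{usage(X_\sigma)}{\sum_{1\le\rho\le\tau}usage(X_\rho)}.$$ The length of code $C_\sigma$ is $-\log P(X_\sigma)$. Define $$L^D_{\mathsf{CT}}(D,CT)=-\sum_{1\le\sigma\le\tau}usage(X_\sigma)\cdot\log(P(X_\sigma)),$$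 $$L^M_{\mathsf{CT}}(CT)=-\sum_{\substack{1\le\sigma\le\tau\\ usage(X_\sigma)>0}}\left(\log(P(X_\sigma))+\sum_{i\in X_\sigma}\log\left(\frac{|D_{\cdot i}|}{|D|}\right)\right),$$ and $L_{\mathsf{CT}}(D,CT)=L^D_{\mathsf{CT}}(D,CT)+L^M_{\mathsf{CT}}(CT)$. Conventions. A term with prefactor $usage(X_\sigma)=0$, $|Y_{\cdot s}|=0$ or $|N_{\cdot i}|=0$ in a data description size contributes $0$. $X_{\cdot s}^Tc$ means $\sum_{i:X_{is}=1}c_i$. *)

theory Defs
  imports Complex_Main "HOL-Library.Disjoint_Sets" "Jordan_Normal_Form.Matrix"
begin

text \<open>Items, transactions and patterns are numbered from 0, following the indexing of
  \<open>mat\<close> and of lists: items are \<open>0, ..., n - 1\<close>, transactions are \<open>0, ..., m - 1\<close>.\<close>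

definition norm1_vec :: "real vec \<Rightarrow> real" where
  "norm1_vec v = (\<Sum>i<dim_vec v. \<bar>v $ i\<bar>)"

definition norm1_mat :: "real mat \<Rightarrow> real" where
  "norm1_mat A = (\<Sum>i<dim_row A. \<Sum>j<dim_col A. \<bar>A $$ (i, j)\<bar>)"

definition theta :: "real \<Rightarrow> real" where
  "theta x = (if x \<ge> 1 / 2 then 1 else 0)"

abbreviation theta_mat :: "real mat \<Rightarrow> real mat" where
  "theta_mat A \<equiv> map_mat theta A"

definition transaction :: "real mat \<Rightarrow> nat \<Rightarrow> nat set" where
  "transaction D j = {i. i < dim_col D \<and> D $$ (j, i) = 1}"

text \<open>The codes, of an arbitrary type \<open>'c\<close>, do not enter the description lengths directly: the
  length attributed to a code is determined by the usage of its pattern.\<close>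

type_synonym 'c code_table = "(nat set \<times> 'c) list"

abbreviation pattern :: "'c code_table \<Rightarrow> nat \<Rightarrow> nat set" where
  "pattern CT \<sigma> \<equiv> fst (CT ! \<sigma>)"

abbreviation patterns :: "'c code_table \<Rightarrow> nat set set" where
  "patterns CT \<equiv> fst ` set CT"

definition is_code_table :: "nat \<Rightarrow> 'c code_table \<Rightarrow> bool" where
  "is_code_table n CT \<longleftrightarrow>
     distinct (map fst CT) \<and> (\<forall>Z\<in>patterns CT. Z \<noteq> {} \<and> Z \<subseteq> {..<n})"

definition num_nonsingletons :: "'c code_table \<Rightarrow> nat" where
  "num_nonsingletons CT = card {Z \<in> patterns CT. card Z \<ge> 2}"

definition nonsingletons_first :: "'c code_table \<Rightarrow> bool" where
  "nonsingletons_first CT \<longleftrightarrow>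
     (\<forall>\<sigma><length CT. card (pattern CT \<sigma>) \<ge> 2 \<longleftrightarrow> \<sigma> < num_nonsingletons CT)"

type_synonym 'c cover_function = "'c code_table \<Rightarrow> nat set \<Rightarrow> nat set set"

definition is_cover_function :: "'c code_table \<Rightarrow> 'c cover_function \<Rightarrow> real mat \<Rightarrow> bool" where
  "is_cover_function CT cover D \<longleftrightarrow>
     (\<forall>j<dim_row D. cover CT (transaction D j) \<subseteq> patterns CT \<and>
        partition_on (transaction D j) (cover CT (transaction D j)))"

definition usage :: "'c cover_function \<Rightarrow> real mat \<Rightarrow> 'c code_table \<Rightarrow> nat set \<Rightarrow> nat" where
  "usage cover D CT Z = card {j. j < dim_row D \<and> Z \<in> cover CT (transaction D j)}"

definition code_prob :: "'c cover_function \<Rightarrow> real mat \<Rightarrow> 'c code_table \<Rightarrow> nat set \<Rightarrow> real" where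
  "code_prob cover D CT Z =
     real (usage cover D CT Z) / (\<Sum>\<rho><length CT. real (usage cover D CT (pattern CT \<rho>)))"

text \<open>In the data sizes below, terms with prefactor 0 contribute 0, since \<open>ln\<close> is total.\<close>

definition L_data :: "'c cover_function \<Rightarrow> real mat \<Rightarrow> 'c code_table \<Rightarrow> real" where
  "L_data cover D CT =
     - (\<Sum>\<sigma><length CT.
          real (usage cover D CT (pattern CT \<sigma>)) * ln (code_prob cover D CT (pattern CT \<sigma>)))"

definition L_model :: "'c cover_function \<Rightarrow> real mat \<Rightarrow> 'c code_table \<Rightarrow> real" where
  "L_model cover D CT =
     - (\<Sum>\<sigma> | \<sigma> < length CT \<and> usage cover D CT (pattern CT \<sigma>) > 0.
          ln (code_prob cover D CT (pattern CT \<sigma>))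
          + (\<Sum>i\<in>pattern CT \<sigma>. ln (norm1_vec (col D i) / norm1_mat D)))"

definition L_CT :: "'c cover_function \<Rightarrow> real mat \<Rightarrow> 'c code_table \<Rightarrow> real" where
  "L_CT cover D CT = L_data cover D CT + L_model cover D CT"

text \<open>The noise matrix \<open>N\<close> is determined by \<open>X\<close>, \<open>Y\<close>, \<open>D\<close> through
  \<open>D = \<theta>(Y X\<^sup>T) + N\<close>.\<close>

definition noise :: "real mat \<Rightarrow> real mat \<Rightarrow> real mat \<Rightarrow> real mat" where
  "noise X Y D = D - theta_mat (Y * transpose_mat X)"

text \<open>The vector \<open>p\<close> of length \<open>r + n\<close>, where \<open>r = dim_col Y\<close>.\<close>

definition bmf_prob :: "real mat \<Rightarrow> real mat \<Rightarrow> nat \<Rightarrow> real" where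
  "bmf_prob Y N k =
     (if k < dim_col Y then norm1_vec (col Y k) else norm1_vec (col N (k - dim_col Y)))
     / (norm1_mat Y + norm1_mat N)"

definition item_cost :: "real mat \<Rightarrow> nat \<Rightarrow> real" where
  "item_cost D i = - ln (norm1_vec (col D i) / norm1_mat D)"

definition f_data :: "real mat \<Rightarrow> real mat \<Rightarrow> real mat \<Rightarrow> real" where
  "f_data X Y D =
     (let N = noise X Y D; r = dim_col Y; n = dim_col D; p = bmf_prob Y N in
      - (\<Sum>s<r. norm1_vec (col Y s) * ln (p s))
      - (\<Sum>i<n. norm1_vec (col N i) * ln (p (r + i))))"

definition f_model :: "real mat \<Rightarrow> real mat \<Rightarrow> real mat \<Rightarrow> real" where
  "f_model X Y D =
     (let N = noise X Y D; r = dim_col Y; n = dim_col D; p = bmf_prob Y N; c = item_cost D in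
      (\<Sum>s | s < r \<and> norm1_vec (col Y s) > 0.
         (\<Sum>i | i < n \<and> X $$ (i, s) = 1. c i) - ln (p s))
      + (\<Sum>i | i < n \<and> norm1_vec (col N i) > 0. c i - ln (p (r + i))))"

definition f_CT :: "real mat \<Rightarrow> real mat \<Rightarrow> real mat \<Rightarrow> real" where
  "f_CT X Y D = f_data X Y D + f_model X Y D"

end

theory Submission
  imports Defs
begin

text \<open>Take \<open>X\<close> and \<open>Y\<close> to be the indicator matrices of the non-singleton patterns and of their use
  in the covers. Since the covering patterns of a transaction are pairwise disjoint, \<open>Y X\<^sup>T\<close> is
  already Boolean, and since they exhaust the transaction, the noise \<open>N\<close> is 1 exactly where an item
  is covered by its singleton. Hence the column sums of \<open>Y\<close> and \<open>N\<close> are the usages of the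
  non-singleton and of the singleton patterns, and all the sums over the code table split
  accordingly; singletons missing from the code table have usage 0.\<close>

section \<open>Sums over the patterns of a code table\<close>

lemma num_nonsingletons_le_length: "num_nonsingletons CT \<le> length CT"
proof -
  have "num_nonsingletons CT \<le> card (patterns CT)"
    unfolding num_nonsingletons_def by (rule card_mono) auto
  also have "\<dots> \<le> length CT"
    by (metis card_length length_map set_map)
  finally show ?thesis .
qed

text \<open>Distinctness turns a sum over positions into one over the set of patterns, and a
  nonempty pattern has either at least two items, hence a position below \<open>r\<close>, or
  exactly one. The code table may lack some singletons; \<open>zero\<close> lets the second sum
  still run over all items.\<close>

lemma sum_patterns_split:
  fixes g :: "nat set \<Rightarrow> 'b :: comm_monoid_add"
  assumes ct: "is_code_table n CT" and nf: "nonsingletons_first CT"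
    and zero: "\<And>i. i < n \<Longrightarrow> {i} \<notin> patterns CT \<Longrightarrow> g {i} = 0"
  shows "(\<Sum>\<sigma><length CT. g (pattern CT \<sigma>)) =
    (\<Sum>s<num_nonsingletons CT. g (pattern CT s)) + (\<Sum>i<n. g {i})"
proof -
  let ?P = "patterns CT" and ?r = "num_nonsingletons CT"
  let ?A = "{Z \<in> ?P. card Z \<ge> 2}" and ?B = "{i. i < n \<and> {i} \<in> ?P}"
  have dist: "distinct (map fst CT)" and ne: "\<And>Z. Z \<in> ?P \<Longrightarrow> Z \<noteq> {} \<and> Z \<subseteq> {..<n}"
    using ct by (auto simp: is_code_table_def)
  have inj: "inj_on (pattern CT) {..<length CT}"
    using dist by (auto simp: inj_on_def distinct_conv_nth)
  have img: "pattern CT ` {..<length CT} = ?P"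
    by (auto simp: set_conv_nth)
  note le = num_nonsingletons_le_length[of CT]
  have imgA: "pattern CT ` {..<?r} = ?A"
  proof
    show "pattern CT ` {..<?r} \<subseteq> ?A"
      using nf le img unfolding nonsingletons_first_def by fastforce
    show "?A \<subseteq> pattern CT ` {..<?r}"
      using nf unfolding nonsingletons_first_def by (auto simp flip: img)
  qed
  have injA: "inj_on (pattern CT) {..<?r}"
    using inj le by (auto elim: inj_on_subset)
  have split: "?P = ?A \<union> (\<lambda>i. {i}) ` ?B"
  proof
    show "?P \<subseteq> ?A \<union> (\<lambda>i. {i}) ` ?B"
    proof
      fix Z assume Z: "Z \<in> ?P"
      then have "Z \<noteq> {}" "Z \<subseteq> {..<n}"
        using ne by auto
      moreover from this have "finite Z"
        by (auto intro: finite_subset)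
      ultimately have "card Z \<noteq> 0" by simp
      then have "card Z \<ge> 2 \<or> card Z = 1" by linarith
      then show "Z \<in> ?A \<union> (\<lambda>i. {i}) ` ?B"
        using Z \<open>Z \<subseteq> {..<n}\<close> by (auto simp: card_1_singleton_iff)
    qed
    show "?A \<union> (\<lambda>i. {i}) ` ?B \<subseteq> ?P" by blast
  qed
  have "(\<Sum>\<sigma><length CT. g (pattern CT \<sigma>)) = sum g ?P"
    using sum.reindex[OF inj, of g] by (simp add: img)
  also have "\<dots> = sum g ?A + sum g ((\<lambda>i. {i}) ` ?B)"
    by (subst split, rule sum.union_disjoint) auto
  also have "sum g ?A = (\<Sum>s<?r. g (pattern CT s))"
    using sum.reindex[OF injA, of g] by (simp add: imgA)
  also have "sum g ((\<lambda>i. {i}) ` ?B) = (\<Sum>i\<in>?B. g {i})"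
    by (subst sum.reindex) auto
  also have "(\<Sum>i\<in>?B. g {i}) = (\<Sum>i<n. g {i})"
    by (rule sum.mono_neutral_left) (auto simp: zero)
  finally show ?thesis .
qed

section \<open>Column norms and partitions\<close>

lemma norm1_mat_eq_sum_cols: "norm1_mat A = (\<Sum>j<dim_col A. norm1_vec (col A j))"
  unfolding norm1_mat_def norm1_vec_def by (subst sum.swap) simp

text \<open>Serves both \<open>Y\<close> and \<open>N\<close>, whose column norms thereby become
  usages.\<close>

lemma norm1_vec_col_indicator:
  assumes "A \<in> carrier_mat m k" "s < k"
    and "\<And>j. j < m \<Longrightarrow> A $$ (j, s) = (if P j then 1 else 0)"
  shows "norm1_vec (col A s) = real (card {j. j < m \<and> P j})"
proof -
  have "norm1_vec (col A s) = (\<Sum>j<m. if P j then 1 else 0)"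
    using assms unfolding norm1_vec_def by (auto intro!: sum.cong)
  also have "\<dots> = real (card {j. j < m \<and> P j})"
    by (simp add: sum.If_cases lessThan_def Collect_conj_eq)
  finally show ?thesis .
qed

lemma partition_on_part_eq:
  assumes "partition_on T C" "Z \<in> C" "W \<in> C" "i \<in> Z" "i \<in> W"
  shows "Z = W"
  using assms unfolding partition_on_def disjoint_def by blast

section \<open>The factorization and its noise\<close>

definition pattern_mat :: "nat \<Rightarrow> 'c code_table \<Rightarrow> real mat" where
  "pattern_mat n CT =
     mat n (num_nonsingletons CT) (\<lambda>(i, s). if i \<in> pattern CT s then 1 else 0)"

definition cover_mat :: "'c cover_function \<Rightarrow> real mat \<Rightarrow> 'c code_table \<Rightarrow> real mat" where
  "cover_mat cover D CT = mat (dim_row D) (num_nonsingletons CT)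
     (\<lambda>(j, s). if pattern CT s \<in> cover CT (transaction D j) then 1 else 0)"

context
  fixes m n :: nat and D :: "real mat" and CT :: "'c code_table" and cover :: "'c cover_function"
  assumes D: "D \<in> carrier_mat m n" and D01: "elements_mat D \<subseteq> {0, 1}"
    and ct: "is_code_table n CT" and nf: "nonsingletons_first CT"
    and cov: "is_cover_function CT cover D"
begin

private abbreviation (input) "r \<equiv> num_nonsingletons CT"
private abbreviation (input) "X \<equiv> pattern_mat n CT"
private abbreviation (input) "Y \<equiv> cover_mat cover D CT"
private abbreviation (input) "N \<equiv> noise X Y D"
private abbreviation (input) "C j \<equiv> cover CT (transaction D j)"
private abbreviation (input) "u \<equiv> usage cover D CT"
private abbreviation (input) "q \<equiv> code_prob cover D CT"

lemma pattern_mat_carrier: "X \<in> carrier_mat n r"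
  by (simp add: pattern_mat_def)

lemma cover_mat_carrier: "Y \<in> carrier_mat m r"
  using D by (simp add: cover_mat_def)

lemma noise_carrier: "N \<in> carrier_mat m n"
  using D pattern_mat_carrier cover_mat_carrier by (auto simp: noise_def)

text \<open>The entry of the product counts the non-singleton patterns that cover item
  \<open>i\<close> in transaction \<open>j\<close>; a natural number passes the threshold 1/2 iff it
  is nonzero.\<close>

lemma theta_product_entry:
  assumes j: "j < m" and i: "i < n"
  shows "theta ((Y * transpose_mat X) $$ (j, i)) =
    (if \<exists>s<r. pattern CT s \<in> C j \<and> i \<in> pattern CT s then 1 else 0)"
proof -
  let ?S = "{s. s < r \<and> pattern CT s \<in> C j \<and> i \<in> pattern CT s}"
  have "(Y * transpose_mat X) $$ (j, i) =
      (\<Sum>s<r. if pattern CT s \<in> C j \<and> i \<in> pattern CT s then 1 else 0)"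
    using i j D
    by (auto simp: pattern_mat_def cover_mat_def scalar_prod_def lessThan_atLeast0
        intro!: sum.cong)
  also have "\<dots> = real (card ?S)"
    by (simp add: sum.If_cases lessThan_def Collect_conj_eq)
  finally have eq: "(Y * transpose_mat X) $$ (j, i) = real (card ?S)" .
  show ?thesis
  proof (cases "?S = {}")
    case True
    then have "\<not> (\<exists>s<r. pattern CT s \<in> C j \<and> i \<in> pattern CT s)" by blast
    then show ?thesis unfolding eq True by (simp add: theta_def)
  next
    case False
    then have "card ?S \<ge> 1" by (simp add: Suc_le_eq card_gt_0_iff)
    then show ?thesis using False unfolding eq by (auto simp: theta_def)
  qed
qed

text \<open>An item of the transaction lies in exactly one covering pattern. If this is
  \<open>{i}\<close>, the Boolean product misses a 1 of \<open>D\<close>; otherwise both have a 1.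
  Outside the transaction both are 0, so the noise is never -1.\<close>

lemma noise_entry:
  assumes j: "j < m" and i: "i < n"
  shows "N $$ (j, i) = (if {i} \<in> C j then 1 else 0)"
proof -
  let ?T = "transaction D j"
  have part: "partition_on ?T (C j)" and sub: "C j \<subseteq> patterns CT"
    using cov D j by (auto simp: is_cover_function_def)
  have D_entry: "D $$ (j, i) = (if i \<in> \<Union>(C j) then 1 else 0)"
  proof -
    have "D $$ (j, i) \<in> {0, 1}"
      by (rule subsetD[OF D01 elements_matI[OF D j i refl]])
    then show ?thesis
      using D i partition_onD1[OF part] by (auto simp: transaction_def)
  qed
  \<comment> \<open>Besides \<open>{i}\<close>, a covering pattern containing \<open>i\<close> has
    at least two items, so the indexing places it among the columns of \<open>X\<close>.\<close>
  have pat: "\<exists>s<r. Z = pattern CT s" if "Z \<in> C j" "Z \<noteq> {i}" "i \<in> Z" for Z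
  proof -
    have "Z \<in> patterns CT" using sub that by blast
    then obtain \<sigma> where \<sigma>: "\<sigma> < length CT" "Z = pattern CT \<sigma>"
      by (auto simp: set_conv_nth)
    have "finite Z"
      using ct \<open>Z \<in> patterns CT\<close> finite_subset[of Z "{..<n}"] by (auto simp: is_code_table_def)
    have "card Z \<noteq> 0" "card Z \<noteq> 1"
      using \<open>finite Z\<close> that by (auto simp: card_1_singleton_iff)
    then have "card Z \<ge> 2" by linarith
    then show ?thesis using nf \<sigma> by (auto simp: nonsingletons_first_def)
  qed
  have non: "pattern CT s \<noteq> {i}" if "s < r" for s
  proof
    assume "pattern CT s = {i}"
    moreover have "card (pattern CT s) \<ge> 2"
      using nf that num_nonsingletons_le_length[of CT] by (simp add: nonsingletons_first_def)
    ultimately show False by simp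
  qed
  have "N $$ (j, i) = D $$ (j, i) - theta ((Y * transpose_mat X) $$ (j, i))"
    using i j D pattern_mat_carrier cover_mat_carrier by (simp add: noise_def)
  also have "\<dots> = (if {i} \<in> C j then 1 else 0)"
  proof (cases "{i} \<in> C j")
    case True
    then have "\<not> (\<exists>s<r. pattern CT s \<in> C j \<and> i \<in> pattern CT s)"
      using non partition_on_part_eq[OF part True] by blast
    then show ?thesis using True D_entry theta_product_entry[OF j i] by auto
  next
    case False
    then have "i \<in> \<Union>(C j) \<longleftrightarrow> (\<exists>s<r. pattern CT s \<in> C j \<and> i \<in> pattern CT s)"
      using pat by (metis Union_iff)
    then show ?thesis using False D_entry theta_product_entry[OF j i] by auto
  qed
  finally show ?thesis .
qed

section \<open>Usages and code probabilities\<close>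

lemma norm1_col_cover_mat: "s < r \<Longrightarrow> norm1_vec (col Y s) = real (u (pattern CT s))"
  using D cover_mat_carrier unfolding usage_def
  by (subst norm1_vec_col_indicator[where P = "\<lambda>j. pattern CT s \<in> C j"]) (auto simp: cover_mat_def)

lemma norm1_col_noise: "i < n \<Longrightarrow> norm1_vec (col N i) = real (u {i})"
  using D norm1_vec_col_indicator[OF noise_carrier _ noise_entry] by (simp add: usage_def)

text \<open>Covers only use patterns of the code table. This provides the vanishing condition of
  \<open>sum_patterns_split\<close> for missing singletons.\<close>

lemma usage_notin_patterns: "Z \<notin> patterns CT \<Longrightarrow> u Z = 0"
  using cov by (auto simp: usage_def is_cover_function_def)

text \<open>Equates the denominators of \<open>code_prob\<close> and
  \<open>bmf_prob\<close>.\<close>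

lemma total_usage:
  "(\<Sum>\<rho><length CT. real (u (pattern CT \<rho>))) = norm1_mat Y + norm1_mat N"
proof -
  have "(\<Sum>\<rho><length CT. real (u (pattern CT \<rho>))) =
      (\<Sum>s<r. real (u (pattern CT s))) + (\<Sum>i<n. real (u {i}))"
    by (rule sum_patterns_split[OF ct nf]) (simp add: usage_notin_patterns)
  then show ?thesis
    using cover_mat_carrier noise_carrier
    by (simp add: norm1_mat_eq_sum_cols norm1_col_cover_mat norm1_col_noise)
qed

lemma bmf_prob_pattern: "s < r \<Longrightarrow> bmf_prob Y N s = q (pattern CT s)"
  using cover_mat_carrier
  by (simp add: bmf_prob_def code_prob_def total_usage norm1_col_cover_mat)

lemma bmf_prob_item: "i < n \<Longrightarrow> bmf_prob Y N (r + i) = q {i}"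
  using cover_mat_carrier
  by (simp add: bmf_prob_def code_prob_def total_usage norm1_col_noise)

section \<open>Equality of the description lengths\<close>

lemma f_data_eq_L_data: "f_data X Y D = L_data cover D CT"
proof -
  have "(\<Sum>\<sigma><length CT. real (u (pattern CT \<sigma>)) * ln (q (pattern CT \<sigma>))) =
      (\<Sum>s<r. real (u (pattern CT s)) * ln (q (pattern CT s))) +
      (\<Sum>i<n. real (u {i}) * ln (q {i}))"
    by (rule sum_patterns_split[OF ct nf]) (simp add: usage_notin_patterns)
  then show ?thesis
    using D cover_mat_carrier
    by (simp add: f_data_def L_data_def Let_def norm1_col_cover_mat norm1_col_noise
        bmf_prob_pattern bmf_prob_item)
qed

lemma f_model_eq_L_model: "f_model X Y D = L_model cover D CT"
proof -
  let ?c = "item_cost D"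
  define g where "g Z = (if u Z > 0 then (\<Sum>i\<in>Z. ?c i) - ln (q Z) else 0)" for Z
  have "L_model cover D CT =
      (\<Sum>\<sigma> | \<sigma> < length CT \<and> u (pattern CT \<sigma>) > 0.
        (\<Sum>i\<in>pattern CT \<sigma>. ?c i) - ln (q (pattern CT \<sigma>)))"
    unfolding L_model_def item_cost_def sum_negf[symmetric]
    by (rule sum.cong) (simp_all add: sum_negf)
  also have "\<dots> = (\<Sum>\<sigma><length CT. g (pattern CT \<sigma>))"
    by (simp add: g_def sum.If_cases lessThan_def Collect_conj_eq)
  also have "\<dots> = (\<Sum>s<r. g (pattern CT s)) + (\<Sum>i<n. g {i})"
    by (rule sum_patterns_split[OF ct nf]) (simp add: usage_notin_patterns g_def)
  also have "(\<Sum>s<r. g (pattern CT s)) =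
      (\<Sum>s | s < r \<and> u (pattern CT s) > 0.
        (\<Sum>i\<in>pattern CT s. ?c i) - ln (q (pattern CT s)))"
    by (simp add: g_def sum.If_cases lessThan_def Collect_conj_eq)
  also have "\<dots> = (\<Sum>s | s < r \<and> norm1_vec (col Y s) > 0.
      (\<Sum>i | i < n \<and> X $$ (i, s) = 1. ?c i) - ln (bmf_prob Y N s))"
  proof (rule sum.cong)
    fix s assume s: "s \<in> {s. s < r \<and> norm1_vec (col Y s) > 0}"
    then have "CT ! s \<in> set CT"
      using num_nonsingletons_le_length[of CT] by simp
    then have "pattern CT s \<subseteq> {..<n}"
      using ct by (simp add: is_code_table_def)
    \<comment> \<open>Since the pattern contains only items below \<open>n\<close>, column
      \<open>s\<close> of \<open>X\<close> recovers all of it.\<close>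
    then have "{i. i < n \<and> X $$ (i, s) = 1} = pattern CT s"
      using s by (auto simp: pattern_mat_def split: if_splits)
    then show "(\<Sum>i\<in>pattern CT s. ?c i) - ln (q (pattern CT s)) =
      (\<Sum>i | i < n \<and> X $$ (i, s) = 1. ?c i) - ln (bmf_prob Y N s)"
      using s by (simp add: bmf_prob_pattern)
  qed (auto simp: norm1_col_cover_mat)
  also have "(\<Sum>i<n. g {i}) =
      (\<Sum>i | i < n \<and> u {i} > 0. ?c i - ln (q {i}))"
    by (simp add: g_def sum.If_cases lessThan_def Collect_conj_eq)
  also have "\<dots> = (\<Sum>i | i < n \<and> norm1_vec (col N i) > 0. ?c i - ln (bmf_prob Y N (r + i)))"
    by (rule sum.cong) (auto simp: norm1_col_noise bmf_prob_item)
  finally show ?thesis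
    using D cover_mat_carrier by (simp add: f_model_def Let_def)
qed

end

theorem lemma1:
  fixes m n r :: nat and D :: "real mat"
    and CT :: "'c code_table" and cover :: "'c cover_function"
  assumes "D \<in> carrier_mat m n" and "elements_mat D \<subseteq> {0, 1}"
    and "is_code_table n CT"
    and "r = num_nonsingletons CT" and "nonsingletons_first CT"
    and "is_cover_function CT cover D"
  shows "\<exists>X Y N.
    X \<in> carrier_mat n r \<and> elements_mat X \<subseteq> {0, 1} \<and>
    Y \<in> carrier_mat m r \<and> elements_mat Y \<subseteq> {0, 1} \<and>
    N \<in> carrier_mat m n \<and> elements_mat N \<subseteq> {-1, 0, 1} \<and>
    D = theta_mat (Y * transpose_mat X) + N \<and>
    (\<forall>i<n. \<forall>s<r. X $$ (i, s) = 1 \<longleftrightarrow> i \<in> pattern CT s) \<and>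
    (\<forall>j<m. \<forall>s<r. Y $$ (j, s) = 1 \<longleftrightarrow> pattern CT s \<in> cover CT (transaction D j)) \<and>
    L_CT cover D CT = f_CT X Y D \<and>
    f_CT X Y D = f_data X Y D + f_model X Y D \<and>
    f_data X Y D = L_data cover D CT \<and>
    f_model X Y D = L_model cover D CT"
proof -
  let ?X = "pattern_mat n CT" and ?Y = "cover_mat cover D CT"
  let ?N = "noise ?X ?Y D"
  note A = assms(1,2,3,5,6)
  note X = pattern_mat_carrier[OF A] and Y = cover_mat_carrier[OF A] and N = noise_carrier[OF A]
  have "elements_mat ?X \<subseteq> {0, 1}" "elements_mat ?Y \<subseteq> {0, 1}"
    by (auto simp: elements_mat_def pattern_mat_def cover_mat_def)
  moreover have "elements_mat ?N \<subseteq> {-1, 0, 1}"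
    using N noise_entry[OF A] by (auto simp: elements_mat_def)
  \<comment> \<open>The noise is defined as the difference, so only the dimensions have to
    match.\<close>
  moreover have "D = theta_mat (?Y * transpose_mat ?X) + ?N"
    using assms(1) X Y by (intro eq_matI) (auto simp: noise_def)
  moreover have "\<forall>i<n. \<forall>s<r. ?X $$ (i, s) = 1 \<longleftrightarrow> i \<in> pattern CT s"
    using assms(4) by (auto simp: pattern_mat_def)
  moreover have "\<forall>j<m. \<forall>s<r. ?Y $$ (j, s) = 1 \<longleftrightarrow> pattern CT s \<in> cover CT (transaction D j)"
    using assms(1,4) by (auto simp: cover_mat_def)
  moreover note data = f_data_eq_L_data[OF A] and model = f_model_eq_L_model[OF A]
  moreover have "L_CT cover D CT = f_CT ?X ?Y D" "f_CT ?X ?Y D = f_data ?X ?Y D + f_model ?X ?Y D"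
    by (simp_all add: L_CT_def f_CT_def data model)
  ultimately show ?thesis
    using X Y N assms(4) by blast
qed

end
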